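(* Let $k$ be a field, let $n\ge 1$, and let $I\subseteq k[x_1,\dots,x_n]$ be an ideal such that $I\cap k[x_1]=\{0\}$. Then there exists a non-zero polynomial $q\in k[x_1]$ such that $\mathrm{ev}_a(I)\neq k[x_2,\dots,x_n]$ for every $a\in k$ with $q(a)\neq 0$.
   Context: For a field $k$ and $a\in k$, $\mathrm{ev}_a:k[x_1,x_2,\dots,x_n]\to k[x_2,\dots,x_n]$ denotes the evaluation homomorphism $f(x_1,x_2,\dots,x_n)\mapsto f(a,x_2,\dots,x_n)$, and $\mathrm{ev}_a(I)=\{\mathrm{ev}_a(f) : f\in I\}$. When $n=1$, $k[x_2,\dots,x_n]$ means $k$. *)

theory Defs
  imports "HOL-Library.Poly_Mapping" "HOL-Algebra.Ideal"
begin

text \<open>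
  A polynomial with coefficients in \<open>'k\<close> and variables indexed by natural numbers is a finitely
  supported map from exponent vectors, themselves finitely supported, to \<open>'k\<close>. The type has
  infinitely many variables, so \<open>k[x\<^sub>i : i \<in> V]\<close> is singled out as a carrier inside it. All these
  rings share their zero, and \<open>k[x\<^sub>1]\<close> is literally a subset of \<open>k[x\<^sub>1, \<dots>, x\<^sub>n]\<close>.
\<close>

type_synonym 'k mpoly = "(nat \<Rightarrow>\<^sub>0 nat) \<Rightarrow>\<^sub>0 'k"

definition mpolys :: "nat set \<Rightarrow> 'k::zero mpoly set" where
  "mpolys V = {p. \<forall>m\<in>Poly_Mapping.keys p. Poly_Mapping.keys m \<subseteq> V}"

definition mpoly_ring :: "nat set \<Rightarrow> 'k::comm_ring_1 mpoly ring" where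
  "mpoly_ring V = \<lparr>carrier = mpolys V, mult = (*), one = 1, zero = 0, add = (+)\<rparr>"

text \<open>
  Substitution of the constant \<open>a\<close> for \<open>x\<^sub>1\<close>. On \<open>k[x\<^sub>1]\<close> the result is a constant polynomial,
  namely the value at \<open>a\<close>.
\<close>

definition ev :: "'k::comm_ring_1 \<Rightarrow> 'k mpoly \<Rightarrow> 'k mpoly" where
  "ev a p = (\<Sum>m\<in>Poly_Mapping.keys p.
     Poly_Mapping.single (Poly_Mapping.update 1 0 m)
       (Poly_Mapping.lookup p m * a ^ Poly_Mapping.lookup m 1))"

definition mvar :: "nat \<Rightarrow> 'k::comm_ring_1 mpoly" where
  "mvar i = Poly_Mapping.single (Poly_Mapping.single i 1) 1"

lemma mpolys_zero: "0 \<in> mpolys V"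
  by (simp add: mpolys_def)

lemma mpolys_one: "(1 :: 'k::comm_ring_1 mpoly) \<in> mpolys V"
  by (auto simp: mpolys_def single_one[symmetric] simp del: single_one split: if_splits)

lemma mpolys_add: "p \<in> mpolys V \<Longrightarrow> q \<in> mpolys V \<Longrightarrow> p + q \<in> mpolys V"
  using Poly_Mapping.keys_add[of p q] by (fastforce simp: mpolys_def)

lemma mpolys_uminus: "(p :: 'k::comm_ring_1 mpoly) \<in> mpolys V \<Longrightarrow> - p \<in> mpolys V"
  by (simp add: mpolys_def)

lemma mpolys_mult:
  fixes p q :: "'k::comm_ring_1 mpoly"
  assumes "p \<in> mpolys V" "q \<in> mpolys V"
  shows "p * q \<in> mpolys V"
proof -
  have "Poly_Mapping.keys m \<subseteq> V" if m: "m \<in> Poly_Mapping.keys (p * q)" for m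
  proof -
    obtain r s where "m = r + s" "r \<in> Poly_Mapping.keys p" "s \<in> Poly_Mapping.keys q"
      using m Poly_Mapping.keys_mult[of p q] by blast
    then show ?thesis
      using assms Poly_Mapping.keys_add[of r s] by (fastforce simp: mpolys_def)
  qed
  then show ?thesis by (simp add: mpolys_def)
qed

lemma mpolys_sum: "(\<And>x. x \<in> A \<Longrightarrow> f x \<in> mpolys V) \<Longrightarrow> sum f A \<in> mpolys V"
  by (induction A rule: infinite_finite_induct) (auto simp: mpolys_zero mpolys_add)

lemma cring_mpoly_ring: "cring (mpoly_ring V :: 'k::comm_ring_1 mpoly ring)"
proof (rule cringI)
  show "abelian_group (mpoly_ring V :: 'k mpoly ring)"
  proof (rule abelian_groupI)
    fix x :: "'k mpoly"
    assume "x \<in> carrier (mpoly_ring V)"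
    then show "\<exists>y\<in>carrier (mpoly_ring V). y \<oplus>\<^bsub>mpoly_ring V\<^esub> x = \<zero>\<^bsub>mpoly_ring V\<^esub>"
      by (intro bexI[of _ "- x"]) (auto simp: mpoly_ring_def mpolys_uminus)
  qed (auto simp: mpoly_ring_def mpolys_zero mpolys_add add.assoc add.commute)
  show "comm_monoid (mpoly_ring V :: 'k mpoly ring)"
    by (rule comm_monoidI)
      (auto simp: mpoly_ring_def mpolys_one mpolys_mult mult.assoc mult.commute)
qed (auto simp: mpoly_ring_def distrib_right)

lemma ev_superset:
  assumes "finite S" "Poly_Mapping.keys p \<subseteq> S"
  shows "ev a p = (\<Sum>m\<in>S. Poly_Mapping.single (Poly_Mapping.update 1 0 m)
           (Poly_Mapping.lookup p m * a ^ Poly_Mapping.lookup m 1))"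
  unfolding ev_def using assms
  by (intro sum.mono_neutral_left) (auto simp: in_keys_iff)

lemma ev_zero: "ev a 0 = 0"
  by (simp add: ev_def)

lemma ev_single: "ev a (Poly_Mapping.single m c) =
    Poly_Mapping.single (Poly_Mapping.update 1 0 m) (c * a ^ Poly_Mapping.lookup m 1)"
  by (subst ev_superset[of "{m}"]) auto

lemma ev_add: "ev a (p + q) = ev a p + ev a q"
proof -
  let ?S = "Poly_Mapping.keys p \<union> Poly_Mapping.keys q"
  have *: "Poly_Mapping.keys (p + q) \<subseteq> ?S"
    by (rule Poly_Mapping.keys_add)
  show ?thesis
    by (subst (1 2 3) ev_superset[of ?S])
      (use * in \<open>auto simp: lookup_add distrib_right single_add sum.distrib\<close>)
qed

lemma ev_one: "ev a 1 = 1"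
proof -
  have "Poly_Mapping.update 1 0 0 = (0 :: nat \<Rightarrow>\<^sub>0 nat)"
    by (rule poly_mapping_eqI) (simp add: lookup_update)
  then show ?thesis
    using ev_single[of a 0 1] by simp
qed

lemma ev_mult: "ev a (p * q) = ev a p * ev a q"
proof -
  have upd: "Poly_Mapping.update 1 0 (m + m') =
      Poly_Mapping.update 1 0 m + Poly_Mapping.update 1 0 m'" for m m' :: "nat \<Rightarrow>\<^sub>0 nat"
    by (rule poly_mapping_eqI) (simp add: lookup_update lookup_add)
  have decomp: "Poly_Mapping.update m c f = Poly_Mapping.single m c + f"
    if "m \<notin> Poly_Mapping.keys f" for m c and f :: "'a mpoly"
    using that
    by (intro poly_mapping_eqI)
      (auto simp: lookup_update lookup_add lookup_single in_keys_iff when_def)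
  have single: "ev a (Poly_Mapping.single m c * q) = ev a (Poly_Mapping.single m c) * ev a q"
    for m c
  proof (induction q rule: update_induct)
    case const
    then show ?case by (simp add: ev_zero)
  next
    case (update f m' c')
    then show ?case
      by (simp add: decomp distrib_left ev_add ev_single mult_single upd[simplified] lookup_add power_add
          mult_ac)
  qed
  show ?thesis
  proof (induction p rule: update_induct)
    case const
    then show ?case by (simp add: ev_zero)
  next
    case (update f m c)
    then show ?case
      by (simp add: decomp distrib_right ev_add single)
  qed
qed

lemma ev_closed:
  assumes "p \<in> mpolys {1..n}"
  shows "ev a p \<in> mpolys {2..n}"
  unfolding ev_def
proof (rule mpolys_sum)
  fix m
  assume "m \<in> Poly_Mapping.keys p"
  then have "Poly_Mapping.keys m \<subseteq> {1..n}"
    using assms by (auto simp: mpolys_def)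
  then have "Poly_Mapping.keys m - {1} \<subseteq> {2..n}"
    by (auto simp: subset_iff)
  then show "Poly_Mapping.single (Poly_Mapping.update 1 0 m)
      (Poly_Mapping.lookup p m * a ^ Poly_Mapping.lookup m 1) \<in> mpolys {2..n}"
    by (auto simp: mpolys_def keys_update split: if_splits)
qed

lemma ev_ring_hom: "ev a \<in> ring_hom (mpoly_ring {1..n}) (mpoly_ring {2..n})"
  by (rule ring_hom_memI) (auto simp: mpoly_ring_def ev_closed ev_add ev_mult ev_one)

lemma ev_mvar_1: "ev a (mvar 1) = Poly_Mapping.single 0 a"
proof -
  have "Poly_Mapping.update 1 0 (Poly_Mapping.single 1 1) = (0 :: nat \<Rightarrow>\<^sub>0 nat)"
    by (rule poly_mapping_eqI) (simp add: lookup_update lookup_single when_def)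
  then show ?thesis
    unfolding mvar_def ev_single by simp
qed

lemma ev_mvar_other: "i \<noteq> 1 \<Longrightarrow> ev a (mvar i) = mvar i"
proof -
  assume "i \<noteq> 1"
  then have "Poly_Mapping.update 1 0 (Poly_Mapping.single i 1) =
      (Poly_Mapping.single i 1 :: nat \<Rightarrow>\<^sub>0 nat)"
    by (intro poly_mapping_eqI) (simp add: lookup_update lookup_single when_def)
  with \<open>i \<noteq> 1\<close> show ?thesis
    unfolding mvar_def ev_single by (simp add: lookup_single when_def)
qed

lemma ev_const: "ev a (Poly_Mapping.single 0 c) = Poly_Mapping.single 0 c"
proof -
  have "Poly_Mapping.update 1 0 0 = (0 :: nat \<Rightarrow>\<^sub>0 nat)"
    by (rule poly_mapping_eqI) (simp add: lookup_update)
  then show ?thesis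
    unfolding ev_single by simp
qed

lemma ev_univariate:
  assumes "q \<in> mpolys {1}"
  shows "ev a q = Poly_Mapping.single 0
    (\<Sum>m\<in>Poly_Mapping.keys q. Poly_Mapping.lookup q m * a ^ Poly_Mapping.lookup m 1)"
proof -
  have 0: "Poly_Mapping.update 1 0 m = 0" if "m \<in> Poly_Mapping.keys q" for m
  proof (rule poly_mapping_eqI)
    fix k
    have "Poly_Mapping.keys m \<subseteq> {1}"
      using that assms by (auto simp: mpolys_def)
    then have "k \<noteq> 1 \<Longrightarrow> k \<notin> Poly_Mapping.keys m"
      by auto
    then show "Poly_Mapping.lookup (Poly_Mapping.update 1 0 m) k = Poly_Mapping.lookup 0 k"
      by (auto simp: lookup_update in_keys_iff)
  qed
  have sum: "Poly_Mapping.single 0 (sum f A) = (\<Sum>m\<in>A. Poly_Mapping.single 0 (f m))"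
    for f :: "(nat \<Rightarrow>\<^sub>0 nat) \<Rightarrow> 'a" and A
    by (induction A rule: infinite_finite_induct) (auto simp: single_add)
  show ?thesis
    unfolding ev_def sum by (rule sum.cong) (simp_all add: 0[simplified])
qed

end

theory Submission
  imports Complex_Main Defs
begin

text \<open>
  Regard \<open>k[x\<^sub>1, \<dots>, x\<^sub>n]\<close> as polynomials in \<open>x\<^sub>2, \<dots>, x\<^sub>n\<close> over \<open>k[x\<^sub>1]\<close>, with the lexicographic
  order on monomials. By Dickson's lemma finitely many \<open>f\<^sub>i \<in> I\<close> have leading monomials that divide
  all leading monomials of \<open>I\<close>; let \<open>q\<close> be the product of their leading coefficients. If
  \<open>q(a) \<noteq> 0\<close>, then \<open>ev\<^sub>a(f)\<close> is a nonzero constant for no \<open>f \<in> I\<close>. Otherwise take such an \<open>f\<close> with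
  least leading monomial. That monomial is not 1, because \<open>I \<inter> k[x\<^sub>1] = 0\<close>, so the leading
  coefficient of \<open>f\<close> vanishes at \<open>a\<close>. One division step by some \<open>f\<^sub>i\<close> then multiplies \<open>ev\<^sub>a(f)\<close> by
  a nonzero constant and lowers the leading monomial, a contradiction.
\<close>

declare One_nat_def [simp del]

subsection \<open>Dickson's lemma\<close>

text \<open>A monotone subsequence exists; if it decreases, it is constant from the index where its
  minimum is attained.\<close>

lemma nat_seq_mono_subseq:
  fixes s :: "nat \<Rightarrow> nat"
  shows "\<exists>r :: nat \<Rightarrow> nat. strict_mono r \<and> mono (s \<circ> r)"
proof -
  obtain f where f: "strict_mono f" "monoseq (\<lambda>n. s (f n))"
    using seq_monosub by blast
  from f(2) consider "\<forall>m n. m \<le> n \<longrightarrow> s (f m) \<le> s (f n)" | "\<forall>m n. m \<le> n \<longrightarrow> s (f n) \<le> s (f m)"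
    by (auto simp: monoseq_def)
  then show ?thesis
  proof cases
    case 1
    then show ?thesis using f(1) by (intro exI[of _ f]) (simp add: mono_def)
  next
    case 2
    obtain N where N: "\<And>n. s (f N) \<le> s (f n)"
      using ex_has_least_nat[of "\<lambda>_. True" _ "\<lambda>n. s (f n)"] by auto
    have "s (f (N + n)) = s (f N)" for n
      using 2 N by (simp add: le_antisym)
    moreover have "strict_mono (\<lambda>n. f (N + n))"
      using f(1) by (simp add: strict_mono_def)
    ultimately show ?thesis
      by (intro exI[of _ "\<lambda>n. f (N + n)"]) (simp add: mono_def)
  qed
qed

text \<open>One coordinate is treated at a time: thinning the sequence further keeps the earlier
  coordinates monotone.\<close>

lemma nat_vector_seq_mono_subseq:
  fixes s :: "nat \<Rightarrow> 'i \<Rightarrow> nat"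
  assumes "finite V"
  shows "\<exists>r :: nat \<Rightarrow> nat. strict_mono r \<and> (\<forall>i\<in>V. mono (\<lambda>n. s (r n) i))"
  using assms
proof (induction V)
  case empty
  have "strict_mono (id :: nat \<Rightarrow> nat)"
    by (simp add: strict_mono_def)
  then show ?case by blast
next
  case (insert j V)
  obtain r :: "nat \<Rightarrow> nat" where r: "strict_mono r" "\<forall>i\<in>V. mono (\<lambda>n. s (r n) i)"
    using insert.IH by blast
  obtain t :: "nat \<Rightarrow> nat" where t: "strict_mono t" "mono ((\<lambda>n. s (r n) j) \<circ> t)"
    using nat_seq_mono_subseq by blast
  have "strict_mono (r \<circ> t)"
    using r(1) t(1) by (simp add: strict_mono_def)
  moreover have "mono (\<lambda>n. s (r (t n)) i)" if "i \<in> V" for i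
    using that r(2) strict_mono_mono[OF t(1)] by (simp add: mono_def)
  ultimately show ?case
    using t(2) by (intro exI[of _ "r \<circ> t"]) (auto simp: o_def)
qed

lemma dickson:
  fixes S :: "('i \<Rightarrow>\<^sub>0 nat) set"
  assumes "finite V" and S: "\<And>m. m \<in> S \<Longrightarrow> Poly_Mapping.keys m \<subseteq> V"
  obtains B where "finite B" "B \<subseteq> S" "\<And>m. m \<in> S \<Longrightarrow> \<exists>b\<in>B. \<exists>d. m = b + d"
proof
  \<comment> \<open>These are the elements of \<open>S\<close> that are minimal for divisibility. If
    there were infinitely many, a subsequence monotone in every coordinate would contain two
    distinct ones, the first dividing the second.\<close>
  let ?B = "{b\<in>S. \<forall>m\<in>S. (\<exists>d. b = m + d) \<longrightarrow> m = b}"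
  show "finite ?B"
  proof (rule ccontr)
    assume "infinite ?B"
    then obtain s :: "nat \<Rightarrow> ('i \<Rightarrow>\<^sub>0 nat)" where s: "inj s" "range s \<subseteq> ?B"
      using infinite_countable_subset by blast
    obtain r :: "nat \<Rightarrow> nat" where r: "strict_mono r"
      "\<forall>i\<in>V. mono (\<lambda>n. Poly_Mapping.lookup (s (r n)) i)"
      using nat_vector_seq_mono_subseq[OF assms(1), of "\<lambda>n. Poly_Mapping.lookup (s n)"] by blast
    have "Poly_Mapping.lookup (s (r 0)) i \<le> Poly_Mapping.lookup (s (r 1)) i" for i
    proof (cases "i \<in> V")
      case True
      then show ?thesis using r(2) by (simp add: mono_def)
    next
      case False
      then have "i \<notin> Poly_Mapping.keys (s (r 0))"
        using S s(2) by blast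
      then show ?thesis by (simp add: in_keys_iff)
    qed
    \<comment> \<open>The truncated subtraction is exact because the exponents are ordered
      pointwise; minimality of \<open>s (r 1)\<close> then forces equality.\<close>
    then have "s (r 1) = s (r 0) + (s (r 1) - s (r 0))"
      by (intro poly_mapping_eqI) (simp add: lookup_add lookup_minus)
    then have "s (r 0) = s (r 1)"
      using s(2) by blast
    then show False
      using s(1) r(1) by (metis injD strict_mono_eq zero_neq_one)
  qed
  show "?B \<subseteq> S" by blast
  fix m
  assume "m \<in> S"
  \<comment> \<open>Induction on the total degree, which drops on passing to a proper
    divisor.\<close>
  then show "\<exists>b\<in>?B. \<exists>d. m = b + d"
  proof (induction "\<Sum>i\<in>V. Poly_Mapping.lookup m i" arbitrary: m rule: less_induct)
    case less
    show ?case
    proof (cases "m \<in> ?B")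
      case True
      then show ?thesis by (intro bexI[of _ m] exI[of _ 0]) simp_all
    next
      case False
      then obtain m' d where m': "m' \<in> S" "m = m' + d" "m' \<noteq> m"
        using less.prems by blast
      then obtain i where i: "Poly_Mapping.lookup d i \<noteq> 0"
        by (metis add.right_neutral poly_mapping_eqI lookup_zero)
      then have "i \<in> V"
        using S[OF less.prems] m'(2) by (auto simp: in_keys_iff lookup_add)
      then have "(\<Sum>i\<in>V. Poly_Mapping.lookup m' i) < (\<Sum>i\<in>V. Poly_Mapping.lookup m i)"
        using i assms(1) by (intro sum_strict_mono_ex1) (auto simp: m'(2) lookup_add)
      from less.hyps[OF this m'(1)] show ?thesis
        using m'(2) by (auto simp: add.assoc)
    qed
  qed
qed

section \<open>Least elements in the lexicographic order\<close>

lemma monomial_nonneg: "(m :: 'i::linorder \<Rightarrow>\<^sub>0 nat) \<ge> 0"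
proof -
  have "\<not> m < 0"
    by transfer (simp add: less_fun_def)
  then show ?thesis by simp
qed

text \<open>The order is compatible with addition and has least element 0, so a divisor is never
  larger than its multiple. Hence the minimum of a finite Dickson basis is least in
  \<open>S\<close>. Finiteness of \<open>V\<close> matters: \<open>x_1 > x_2 > ...\<close> is an
  infinite descent.\<close>

lemma monomials_have_least:
  fixes S :: "('i::linorder \<Rightarrow>\<^sub>0 nat) set"
  assumes "finite V" "\<And>m. m \<in> S \<Longrightarrow> Poly_Mapping.keys m \<subseteq> V" "S \<noteq> {}"
  obtains m where "m \<in> S" "\<And>m'. m' \<in> S \<Longrightarrow> m \<le> m'"
proof -
  obtain B where B: "finite B" "B \<subseteq> S" "\<And>m. m \<in> S \<Longrightarrow> \<exists>b\<in>B. \<exists>d. m = b + d"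
    using dickson[OF assms(1,2)] by blast
  then have "B \<noteq> {}"
    using assms(3) by blast
  show ?thesis
  proof
    show "Min B \<in> S"
      using B \<open>B \<noteq> {}\<close> by (meson Min_in subsetD)
    fix m'
    assume "m' \<in> S"
    then obtain b d where "b \<in> B" "m' = b + d"
      using B(3) by blast
    moreover have "b \<le> b + d"
      using add_left_mono[OF monomial_nonneg, of b d] by simp
    ultimately show "Min B \<le> m'"
      using B(1) by (metis Min_le order_trans)
  qed
qed

subsection \<open>Leading terms over \<open>k[x\<^sub>1]\<close>\<close>

abbreviation strip :: "(nat \<Rightarrow>\<^sub>0 nat) \<Rightarrow> nat \<Rightarrow>\<^sub>0 nat" where
  "strip m \<equiv> Poly_Mapping.update 1 0 m"

abbreviation monomial :: "(nat \<Rightarrow>\<^sub>0 nat) \<Rightarrow> 'k::comm_ring_1 mpoly" where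
  "monomial m \<equiv> Poly_Mapping.single m 1"

text \<open>\<open>strip m\<close> is the part of \<open>m\<close> free of \<open>x_1\<close>, so
  comparing stripped monomials treats a polynomial as one over \<open>k[x_1]\<close> without
  changing its type.\<close>

definition below :: "(nat \<Rightarrow>\<^sub>0 nat) \<Rightarrow> 'k::zero mpoly set" where
  "below \<mu> = {g. \<forall>m\<in>Poly_Mapping.keys g. strip m < \<mu>}"

text \<open>Here \<mu> is the leading monomial and \<open>c\<close> the leading coefficient of
  \<open>p\<close> viewed over \<open>k[x_1]\<close>.\<close>

definition lead :: "'k::comm_ring_1 mpoly \<Rightarrow> (nat \<Rightarrow>\<^sub>0 nat) \<Rightarrow> 'k mpoly \<Rightarrow> bool" where
  "lead p \<mu> c \<longleftrightarrow> c \<in> mpolys {1} \<and> c \<noteq> 0 \<and> Poly_Mapping.lookup \<mu> 1 = 0 \<and>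
     p - c * monomial \<mu> \<in> below \<mu>"

lemma strip_add: "strip (m + m') = strip m + strip m'"
  by (rule poly_mapping_eqI) (simp add: lookup_update lookup_add)

lemma strip_id: "Poly_Mapping.lookup m 1 = 0 \<Longrightarrow> strip m = m"
  by (rule poly_mapping_eqI) (simp add: lookup_update)

lemma strip_eq_0: "Poly_Mapping.keys m \<subseteq> {1} \<Longrightarrow> strip m = 0"
  by (rule poly_mapping_eqI) (auto simp: lookup_update in_keys_iff subset_iff)

lemma strip_decomp: "m = Poly_Mapping.single 1 (Poly_Mapping.lookup m 1) + strip m"
  by (rule poly_mapping_eqI) (simp add: lookup_update lookup_add lookup_single when_def)

lemma below_diff:
  fixes p q :: "'k::comm_ring_1 mpoly"
  shows "p \<in> below \<mu> \<Longrightarrow> q \<in> below \<mu> \<Longrightarrow> p - q \<in> below \<mu>"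
  using keys_diff[of p q] by (auto simp: below_def)

lemma below_mult_coeff:
  fixes p c :: "'k::comm_ring_1 mpoly"
  assumes "p \<in> below \<mu>" "c \<in> mpolys {1}"
  shows "c * p \<in> below \<mu>"
  unfolding below_def
proof (clarify)
  fix m
  assume "m \<in> Poly_Mapping.keys (c * p)"
  then obtain r s where "m = r + s" "r \<in> Poly_Mapping.keys c" "s \<in> Poly_Mapping.keys p"
    using Poly_Mapping.keys_mult[of c p] by blast
  with assms show "strip m < \<mu>"
    by (simp add: below_def mpolys_def strip_add strip_eq_0)
qed

lemma below_mult_monomial:
  fixes p :: "'k::comm_ring_1 mpoly"
  assumes "p \<in> below \<mu>" "Poly_Mapping.lookup \<nu> 1 = 0"
  shows "monomial \<nu> * p \<in> below (\<mu> + \<nu>)"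
  unfolding below_def
proof (clarify)
  fix m
  assume "m \<in> Poly_Mapping.keys (monomial \<nu> * p)"
  then obtain s where "m = \<nu> + s" "s \<in> Poly_Mapping.keys p"
    using Poly_Mapping.keys_mult[of "monomial \<nu>" p] by (auto split: if_splits)
  with assms show "strip m < \<mu> + \<nu>"
    using add_strict_left_mono[of "strip s" \<mu> \<nu>]
    by (simp add: below_def strip_add strip_id add.commute[of \<mu>])
qed

lemma below_0: "p \<in> below 0 \<Longrightarrow> p = 0"
proof -
  assume "p \<in> below 0"
  then have "Poly_Mapping.keys p = {}"
    using monomial_nonneg leD unfolding below_def by blast
  then show "p = 0" by simp
qed

text \<open>Evaluation moves a term at \<open>m\<close> to \<open>strip m\<close>, so nothing lands
  on \<mu>.\<close>

lemma lookup_ev_below: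
  assumes "p \<in> below \<mu>"
  shows "Poly_Mapping.lookup (ev a p) \<mu> = 0"
proof -
  have "strip m \<noteq> \<mu>" if "m \<in> Poly_Mapping.keys p" for m
    using that assms by (auto simp: below_def)
  then show ?thesis
    by (simp add: ev_def lookup_sum lookup_single when_def)
qed

text \<open>The largest stripped monomial serves as \<mu>, and \<open>c\<close> collects the
  \<open>x_1\<close>-parts of the terms above it. The last conclusion is what makes leading
  monomials drop strictly in the descent.\<close>

lemma lead_exists:
  fixes p :: "'k::comm_ring_1 mpoly"
  assumes "p \<in> mpolys V" "p \<noteq> 0"
  obtains \<mu> c where "Poly_Mapping.keys \<mu> \<subseteq> V" "lead p \<mu> c"
    "\<And>\<nu>. p \<in> below \<nu> \<Longrightarrow> \<mu> < \<nu>"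
proof -
  let ?K = "Poly_Mapping.keys p"
  define \<mu> where "\<mu> = Max (strip ` ?K)"
  have "\<mu> \<in> strip ` ?K"
    unfolding \<mu>_def using assms(2) by (intro Max_in) simp_all
  then obtain m0 where m0: "m0 \<in> ?K" "\<mu> = strip m0"
    by blast
  have max: "strip m \<le> \<mu>" if "m \<in> ?K" for m
    unfolding \<mu>_def using that by (intro Max_ge) simp_all
  let ?T = "\<lambda>m. Poly_Mapping.single m (Poly_Mapping.lookup p m)"
  define L where "L = {m\<in>?K. strip m = \<mu>}"
  define c :: "'k mpoly" where "c = (\<Sum>m\<in>L. Poly_Mapping.single
    (Poly_Mapping.single 1 (Poly_Mapping.lookup m 1)) (Poly_Mapping.lookup p m))"
  have cm: "c * monomial \<mu> = (\<Sum>m\<in>L. ?T m)"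
    unfolding c_def sum_distrib_right
    by (rule sum.cong) (auto simp: L_def mult_single strip_decomp[symmetric])
  \<comment> \<open>The product is exactly the part of \<open>p\<close> supported on
    \<open>L\<close>, so subtracting it leaves only terms with smaller stripped monomial.\<close>
  have lk: "Poly_Mapping.lookup (c * monomial \<mu>) m =
      (if m \<in> L then Poly_Mapping.lookup p m else 0)" for m
  proof -
    have "finite L" by (simp add: L_def)
    then show ?thesis
      by (simp add: cm lookup_sum lookup_single when_def sum.delta)
  qed
  have "c \<in> mpolys {1}"
    unfolding c_def by (rule mpolys_sum) (auto simp: mpolys_def split: if_splits)
  moreover have "c \<noteq> 0"
    using lk[of m0] m0 by (auto simp: L_def in_keys_iff)
  moreover have "Poly_Mapping.lookup \<mu> 1 = 0"
    by (simp add: m0(2) lookup_update)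
  moreover have "p - c * monomial \<mu> \<in> below \<mu>"
    unfolding below_def
  proof (clarify)
    fix m
    assume "m \<in> Poly_Mapping.keys (p - c * monomial \<mu>)"
    then have "m \<in> ?K" "m \<notin> L"
      by (auto simp: in_keys_iff lookup_minus lk split: if_splits)
    then show "strip m < \<mu>"
      using max[of m] by (simp add: L_def)
  qed
  ultimately have "lead p \<mu> c"
    by (simp add: lead_def)
  moreover have "Poly_Mapping.keys \<mu> \<subseteq> V"
    using m0 assms(1) by (auto simp: mpolys_def keys_update)
  moreover have "\<mu> < \<nu>" if "p \<in> below \<nu>" for \<nu>
    using that m0 by (auto simp: below_def)
  ultimately show ?thesis
    using that by blast
qed

section \<open>Evaluation and division of leading terms\<close>

lemma ev_coeff_const:
  assumes "c \<in> mpolys {1}"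
  obtains e where "ev a c = Poly_Mapping.single 0 e"
  using ev_univariate[OF assms] by blast

text \<open>Compare coefficients at \<mu>: lower terms contribute nothing, so the coefficient of
  \<open>ev a p\<close> there is the value of \<open>c\<close> at \<open>a\<close>, while a constant
  has coefficient 0 at a nontrivial monomial.\<close>

lemma ev_lead_eq_0:
  assumes "lead p \<mu> c" "\<mu> \<noteq> 0" "ev a p = Poly_Mapping.single 0 e"
  shows "ev a c = 0"
proof -
  have "c \<in> mpolys {1}" and \<mu>: "strip \<mu> = \<mu>" "Poly_Mapping.lookup \<mu> 1 = 0"
    and g: "p - c * monomial \<mu> \<in> below \<mu>"
    using assms(1) by (simp_all add: lead_def strip_id)
  then obtain d where d: "ev a c = Poly_Mapping.single 0 d"
    using ev_coeff_const by blast
  have "ev a p = ev a (c * monomial \<mu>) + ev a (p - c * monomial \<mu>)"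
    by (simp flip: ev_add)
  also have "ev a (c * monomial \<mu>) = Poly_Mapping.single \<mu> d"
    by (simp add: ev_mult d ev_single \<mu> mult_single)
  finally have "Poly_Mapping.lookup (ev a p) \<mu> = d"
    using lookup_ev_below[OF g] by (simp add: lookup_add)
  then show ?thesis
    using assms(2,3) d by (simp add: lookup_single)
qed

text \<open>Cross-multiplying by the leading coefficients cancels the leading terms without dividing
  in \<open>k[x_1]\<close>; only multiples of the two remainders survive.\<close>

lemma division_step_below:
  assumes p: "lead p (\<nu> + d) c" and f: "lead f \<nu> c'"
  shows "c' * p - c * monomial d * f \<in> below (\<nu> + d)"
proof -
  have "Poly_Mapping.lookup d 1 = 0"
    using p by (simp add: lead_def lookup_add)
  moreover have "c' * p - c * monomial d * f =
      c' * (p - c * monomial (\<nu> + d)) - c * (monomial d * (f - c' * monomial \<nu>))"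
  proof -
    have "monomial (\<nu> + d) = (monomial \<nu> * monomial d :: 'a mpoly)"
      by (simp add: mult_single)
    then show ?thesis by (simp add: algebra_simps)
  qed
  ultimately show ?thesis
    using p f by (auto simp: lead_def intro!: below_diff below_mult_coeff below_mult_monomial)
qed

section \<open>The polynomial \<open>q\<close> and the descent\<close>

lemma ev_prod: "ev a (prod f A) = (\<Prod>x\<in>A. ev a (f x))"
  by (induction A rule: infinite_finite_induct) (simp_all add: ev_one ev_mult)

lemma mpolys_prod:
  fixes f :: "'b \<Rightarrow> 'k::comm_ring_1 mpoly"
  shows "(\<And>x. x \<in> A \<Longrightarrow> f x \<in> mpolys V) \<Longrightarrow> prod f A \<in> mpolys V"
  by (induction A rule: infinite_finite_induct) (auto simp: mpolys_one mpolys_mult)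

theorem lemma2:
  fixes n :: nat and I :: "'k::field mpoly set"
  assumes "n \<ge> 1"
    and "ideal I (mpoly_ring {1..n})"
    and "I \<inter> carrier (mpoly_ring {1}) = {0}"
  shows "\<exists>q\<in>carrier (mpoly_ring {1}). q \<noteq> 0 \<and>
    (\<forall>a::'k. ev a q \<noteq> 0 \<longrightarrow> ev a ` I \<noteq> carrier (mpoly_ring {2..n}))"
proof -
  interpret ideal I "mpoly_ring {1..n}" by (rule assms(2))
  have sub: "p \<in> mpolys {1..n}" if "p \<in> I" for p
    using a_subset that by (auto simp: mpoly_ring_def)
  have mult: "r * p \<in> I" if "p \<in> I" "r \<in> mpolys {1..n}" for p r
    using I_l_closed[of p r] that by (simp add: mpoly_ring_def)
  have add: "p + r \<in> I" if "p \<in> I" "r \<in> I" for p r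
    using additive_subgroup.a_closed[OF is_additive_subgroup, of p r] that by (simp add: mpoly_ring_def)
  have diff: "p - r \<in> I" if "p \<in> I" "r \<in> I" for p r
    using add[OF that(1) mult[OF that(2) mpolys_uminus[OF mpolys_one]]] by simp
  \<comment> \<open>The assumption \<open>n \<ge> 1\<close> enters here: it puts
    \<open>k[x_1]\<close> inside the ring.\<close>
  have univ: "c \<in> mpolys {1..n}" if "c \<in> mpolys {1}" for c :: "'k mpoly"
    using that assms(1) by (fastforce simp: mpolys_def)
  define S where "S = {\<mu>. Poly_Mapping.keys \<mu> \<subseteq> {1..n} \<and> (\<exists>f\<in>I. \<exists>c. lead f \<mu> c)}"
  obtain B where B: "finite B" "B \<subseteq> S" "\<And>m. m \<in> S \<Longrightarrow> \<exists>b\<in>B. \<exists>d. m = b + d"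
  proof (rule dickson[of "{1..n}" S])
    show "Poly_Mapping.keys m \<subseteq> {1..n}" if "m \<in> S" for m
      using that by (simp add: S_def)
  qed auto
  have "\<forall>\<nu>\<in>B. \<exists>f c. f \<in> I \<and> lead f \<nu> c"
    using B(2) unfolding S_def by blast
  then obtain f c where fc: "\<And>\<nu>. \<nu> \<in> B \<Longrightarrow> f \<nu> \<in> I \<and> lead (f \<nu>) \<nu> (c \<nu>)"
    by metis
  have c: "c \<nu> \<in> mpolys {1}" "c \<nu> \<noteq> 0" if "\<nu> \<in> B" for \<nu>
    using fc[OF that] by (auto simp: lead_def)
  define q where "q = prod c B"
  have "ev a ` I \<noteq> carrier (mpoly_ring {2..n})" if q: "ev a q \<noteq> 0" for a
  proof
    assume "ev a ` I = carrier (mpoly_ring {2..n})"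
    then have "1 \<in> ev a ` I"
      by (simp add: mpoly_ring_def mpolys_one)
    then obtain p1 where p1: "p1 \<in> I" "ev a p1 = Poly_Mapping.single 0 1"
      by (metis imageE single_one)
    \<comment> \<open>Any nonzero constant is allowed, not just 1, because a division step rescales
      the evaluation.\<close>
    define P where "P p \<longleftrightarrow> p \<in> I \<and> (\<exists>e. e \<noteq> 0 \<and> ev a p = Poly_Mapping.single 0 e)" for p
    have nz: "p \<noteq> 0" if "P p" for p
      using that
      by (auto simp: P_def ev_zero dest: arg_cong[of _ _ "\<lambda>p. Poly_Mapping.lookup p 0"])
    define M where "M = {\<mu>. Poly_Mapping.keys \<mu> \<subseteq> {1..n} \<and> (\<exists>p. P p \<and> (\<exists>c. lead p \<mu> c))}"
    have "P p1"
      using p1 zero_neq_one unfolding P_def by metis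
    obtain \<mu>1 c1 where "Poly_Mapping.keys \<mu>1 \<subseteq> {1..n}" "lead p1 \<mu>1 c1"
      using lead_exists[OF sub[OF p1(1)] nz[OF \<open>P p1\<close>]] by metis
    then have "M \<noteq> {}"
      using \<open>P p1\<close> by (auto simp: M_def)
    obtain \<mu> where \<mu>: "\<mu> \<in> M" "\<And>\<mu>'. \<mu>' \<in> M \<Longrightarrow> \<mu> \<le> \<mu>'"
    proof (rule monomials_have_least[of "{1..n}" M])
      show "Poly_Mapping.keys m \<subseteq> {1..n}" if "m \<in> M" for m
        using that by (simp add: M_def)
    qed (use \<open>M \<noteq> {}\<close> in auto)
    from \<mu>(1) obtain p cp where p: "P p" "lead p \<mu> cp"
      by (auto simp: M_def)
    then obtain e where pI: "p \<in> I" and e: "e \<noteq> 0" "ev a p = Poly_Mapping.single 0 e"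
      by (auto simp: P_def)
    have cp: "cp \<in> mpolys {1}"
      using p(2) by (simp add: lead_def)
    \<comment> \<open>Otherwise \<open>p\<close> equals its leading coefficient and is a nonzero
      element of \<open>I\<close> in \<open>k[x_1]\<close>.\<close>
    have "\<mu> \<noteq> 0"
    proof
      assume "\<mu> = 0"
      then have "p = cp"
        using p(2) below_0 by (fastforce simp: lead_def)
      then show False
        using pI cp assms(3) nz[OF p(1)] by (auto simp: mpoly_ring_def)
    qed
    then have ev_cp: "ev a cp = 0"
      using ev_lead_eq_0 p(2) e(2) by blast
    have "\<mu> \<in> S"
      using \<mu>(1) by (auto simp: S_def M_def P_def)
    then obtain \<nu> d where \<nu>: "\<nu> \<in> B" and d: "\<mu> = \<nu> + d"
      using B(3) by blast
    \<comment> \<open>The cofactor must involve only \<open>x_1, ..., x_n\<close> for its multiples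
      of \<open>f \<nu>\<close> to stay in \<open>I\<close>.\<close>
    have "Poly_Mapping.keys d \<subseteq> {1..n}"
      using \<mu>(1) d by (auto simp: M_def in_keys_iff lookup_add subset_iff)
    then have d_mem: "monomial d \<in> mpolys {1..n}"
      by (simp add: mpolys_def)
    define p' where "p' = c \<nu> * p - cp * monomial d * f \<nu>"
    have "p' \<in> below \<mu>"
      unfolding p'_def d using division_step_below p(2) fc[OF \<nu>] d by blast
    have "p' \<in> I"
      unfolding p'_def using fc[OF \<nu>] pI c(1)[OF \<nu>] cp d_mem
      by (intro diff mult) (auto intro: univ mpolys_mult)
    \<comment> \<open>The subtracted multiple of \<open>f \<nu>\<close> carries the factor
      \<open>cp\<close>, which vanishes at \<open>a\<close>.\<close>
    have "ev a p' = ev a (c \<nu>) * ev a p"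
    proof -
      have "ev a (c \<nu>) * ev a p = ev a (p' + cp * monomial d * f \<nu>)"
        by (simp add: p'_def flip: ev_mult)
      then show ?thesis
        by (simp add: ev_add ev_mult ev_cp)
    qed
    moreover obtain e' where e': "ev a (c \<nu>) = Poly_Mapping.single 0 e'"
      using ev_coeff_const c(1)[OF \<nu>] by blast
    \<comment> \<open>\<open>ev a (c \<nu>)\<close> is a factor of \<open>ev a q\<close>.\<close>
    moreover have "ev a (c \<nu>) \<noteq> 0"
      using q B(1) \<nu> by (auto simp: q_def ev_prod)
    ultimately have "e' * e \<noteq> 0" "ev a p' = Poly_Mapping.single 0 (e' * e)"
      using e by (auto simp: mult_single)
    then have "P p'"
      using \<open>p' \<in> I\<close> unfolding P_def by blast
    \<comment> \<open>So \<open>p'\<close> again evaluates to a nonzero constant, with leading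
      monomial below the least possible one.\<close>
    obtain \<mu>' c' where "Poly_Mapping.keys \<mu>' \<subseteq> {1..n}" "lead p' \<mu>' c'" "\<mu>' < \<mu>"
      using lead_exists[OF sub[OF \<open>p' \<in> I\<close>] nz[OF \<open>P p'\<close>]] \<open>p' \<in> below \<mu>\<close> by metis
    moreover from this have "\<mu>' \<in> M"
      using \<open>P p'\<close> unfolding M_def by blast
    ultimately show False
      using \<mu>(2)[of \<mu>'] by simp
  qed
  moreover have "q \<in> carrier (mpoly_ring {1})"
    unfolding q_def mpoly_ring_def using c(1) by (auto intro: mpolys_prod)
  moreover have "q \<noteq> 0"
    using B(1) c(2) by (simp add: q_def)
  ultimately show ?thesis
    by blast
qed

end
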